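(* For every positive integer $m$, \[\nu(m)\geq 3\prod_{i=0}^{\lceil m/3\rceil-2} (m-3i),\] where an empty product equals $1$.
   Context: A matroid on a finite set $S$ is a family $\mathcal{M}$ of subsets of $S$ with $\emptyset\in\mathcal{M}$, closed under subsets, such that for every $A\subseteq S$ all maximal members of $\mathcal{M}$ contained in $A$ have the same cardinality. For a finite simple graph $G=(V,E)$, $M(G)$ is the family of all matchings (sets of pairwise disjoint edges) of $G$, and $\mu(G)$ is the minimum $m\in\mathbb{N}$ such that $M(G)$ is the intersection $\mathcal{M}_1\cap\dots\cap\mathcal{M}_m$ of $m$ matroids on $E$. For $n\in\mathbb{N}$, $\mu(n)=\max\{\mu(G): G \text{ a finite simple graph with } |V|\le n\}$, and for $m\in\mathbb{N}$, $\nu(m)=\sup\{n\in\mathbb{N}:\mu(n)\le m\}$. *)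

theory Defs
  imports Complex_Main "HOL-Library.Extended_Nat" "HOL-Library.Disjoint_Sets"
begin

definition maximal_in :: "'a set set \<Rightarrow> 'a set \<Rightarrow> 'a set \<Rightarrow> bool" where
  "maximal_in M A X \<longleftrightarrow> X \<in> M \<and> X \<subseteq> A \<and> (\<forall>Y\<in>M. Y \<subseteq> A \<longrightarrow> X \<subseteq> Y \<longrightarrow> Y = X)"

definition matroid_on :: "'a set \<Rightarrow> 'a set set \<Rightarrow> bool" where
  "matroid_on S M \<longleftrightarrow>
     finite S \<and> M \<subseteq> Pow S \<and> {} \<in> M \<and>
     (\<forall>X\<in>M. \<forall>Y. Y \<subseteq> X \<longrightarrow> Y \<in> M) \<and>
     (\<forall>A. A \<subseteq> S \<longrightarrow> (\<forall>X Y. maximal_in M A X \<longrightarrow> maximal_in M A Y \<longrightarrow> card X = card Y))"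

definition finite_simple_graph :: "'v set \<Rightarrow> 'v set set \<Rightarrow> bool" where
  "finite_simple_graph V E \<longleftrightarrow> finite V \<and> (\<forall>e\<in>E. e \<subseteq> V \<and> card e = 2)"

definition matchings :: "'v set set \<Rightarrow> 'v set set set" where
  "matchings E = {F. F \<subseteq> E \<and> disjoint F}"

text \<open>The matchings of a graph, and hence this parameter, depend only on its edge set. Families of
  no matroids are excluded, so the value is at least \<open>1\<close>.\<close>

definition mu_graph :: "'v set set \<Rightarrow> nat" where
  "mu_graph E = (LEAST m. m \<ge> 1 \<and>
     (\<exists>\<M>. (\<forall>i\<in>{1..m}. matroid_on E (\<M> i)) \<and> matchings E = (\<Inter>i\<in>{1..m::nat}. \<M> i)))"

text \<open>Every finite graph is isomorphic to one whose vertices are natural numbers, so it suffices to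
  let the maximum range over the latter.\<close>

definition mu :: "nat \<Rightarrow> nat" where
  "mu n = Max {mu_graph E | (V :: nat set) E. finite_simple_graph V E \<and> card V \<le> n}"

text \<open>The supremum is taken in the extended naturals, where it exists without
  assuming boundedness.\<close>

definition nu :: "nat \<Rightarrow> enat" where
  "nu m = (SUP n\<in>{n. mu n \<le> m}. enat n)"

end

theory Submission
  imports Defs
begin

text \<open>Induction on \<open>m\<close> in steps of three: if \<open>m - 3\<close> matroids suffice for all graphs on at most
  \<open>n\<close> vertices, then \<open>m \<ge> 4\<close> matroids suffice on at most \<open>m n\<close> vertices. Split the vertices into
  parts \<open>V\<^sub>0, \<dots>, V\<^bsub>m-1\<^esub>\<close> of size at most \<open>n\<close>, with indices read modulo \<open>m\<close>. Each matroid is a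
  direct sum in which an edge is either charged to one of its endpoints (at most one edge per
  vertex) or, if it lies inside a part, belongs to a matroid of that part. An edge inside \<open>V\<^sub>i\<close>
  is charged to its smaller endpoint in matroid \<open>i\<close>, to its larger endpoint in matroids \<open>i + 1\<close> and
  \<open>i + 2\<close>, and in the other \<open>m - 3\<close> matroids it follows the given representation for \<open>V\<^sub>i\<close>. An
  edge between \<open>u \<in> V\<^sub>i\<close> and \<open>v \<in> V\<^sub>j\<close> is charged to \<open>u\<close> in matroid \<open>i\<close> and in one of the matroids
  \<open>i + 1\<close>, \<open>i + 2\<close>, and symmetrically for \<open>v\<close>; for \<open>m \<ge> 4\<close> these four matroids can be chosen
  distinct. Hence any two edges meeting in a vertex are charged to it in a common matroid, or are
  separated by the representation of their part.\<close>

section \<open>Matroids: direct sums and rank one\<close>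

lemma matroid_onD:
  assumes "matroid_on S M"
  shows "M \<subseteq> Pow S" and "{} \<in> M"
    and "\<forall>X\<in>M. \<forall>Y. Y \<subseteq> X \<longrightarrow> Y \<in> M"
    and "\<forall>A. A \<subseteq> S \<longrightarrow> (\<forall>X Y. maximal_in M A X \<longrightarrow> maximal_in M A Y \<longrightarrow> card X = card Y)"
  using assms unfolding matroid_on_def by - (elim conjE, assumption)+

lemma matroid_on_subset: "matroid_on S M \<Longrightarrow> X \<in> M \<Longrightarrow> X \<subseteq> S"
  using matroid_onD(1) by fast

lemma matroid_on_down: "matroid_on S M \<Longrightarrow> X \<in> M \<Longrightarrow> Y \<subseteq> X \<Longrightarrow> Y \<in> M"
  using matroid_onD(3) by metis

lemma matroid_on_card_eq:
  "matroid_on S M \<Longrightarrow> A \<subseteq> S \<Longrightarrow> maximal_in M A X \<Longrightarrow> maximal_in M A Y \<Longrightarrow> card X = card Y"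
  using matroid_onD(4) by metis

lemma matroid_onI:
  assumes "finite S" and "{} \<in> M" and "\<And>X. X \<in> M \<Longrightarrow> X \<subseteq> S"
    and "\<And>X Y. X \<in> M \<Longrightarrow> Y \<subseteq> X \<Longrightarrow> Y \<in> M"
    and "\<And>A X Y. A \<subseteq> S \<Longrightarrow> maximal_in M A X \<Longrightarrow> maximal_in M A Y \<Longrightarrow> card X = card Y"
  shows "matroid_on S M"
  unfolding matroid_on_def
  using assms(1,2) assms(3)[THEN subsetD] assms(4,5) by (intro conjI allI impI ballI subsetI PowI)

lemma maximal_inD:
  assumes "maximal_in M A X"
  shows "X \<in> M" and "X \<subseteq> A" and "Y \<in> M \<Longrightarrow> Y \<subseteq> A \<Longrightarrow> X \<subseteq> Y \<Longrightarrow> Y = X"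
  using assms unfolding maximal_in_def by - (elim conjE; simp)+

text \<open>A set that is maximal within \<open>A\<close> meets every fibre of \<open>c\<close> in a
  maximal set, since enlarging it inside one fibre leaves the conditions on the others untouched.
  Cardinalities then agree fibre by fibre and add up.\<close>

lemma matroid_on_direct_sum:
  assumes "finite S"
    and mat: "\<And>b. b \<in> c ` S \<Longrightarrow> matroid_on {e\<in>S. c e = b} (M b)"
  shows "matroid_on S {X. X \<subseteq> S \<and> (\<forall>b\<in>c ` S. X \<inter> {e\<in>S. c e = b} \<in> M b)}"
    (is "matroid_on S ?D")
proof -
  have D_down: "Y \<in> ?D" if "X \<in> ?D" "Y \<subseteq> X" for X Y
  proof -
    have "Y \<inter> {e\<in>S. c e = b} \<in> M b" if b: "b \<in> c ` S" for b
    proof (rule matroid_on_down[OF mat[OF b]])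
      show "X \<inter> {e\<in>S. c e = b} \<in> M b" using \<open>X \<in> ?D\<close> b by blast
      show "Y \<inter> {e\<in>S. c e = b} \<subseteq> X \<inter> {e\<in>S. c e = b}" using \<open>Y \<subseteq> X\<close> by blast
    qed
    moreover have "X \<subseteq> S" using that(1) by simp
    then have "Y \<subseteq> S" using that(2) by simp
    ultimately show ?thesis by simp
  qed
  have fibre_maximal: "maximal_in (M b) (A \<inter> {e\<in>S. c e = b}) (X \<inter> {e\<in>S. c e = b})"
    if X: "maximal_in ?D A X" and b: "b \<in> c ` S" for A X b
    unfolding maximal_in_def
  proof (intro conjI ballI impI)
    show "X \<inter> {e\<in>S. c e = b} \<in> M b" "X \<inter> {e\<in>S. c e = b} \<subseteq> A \<inter> {e\<in>S. c e = b}"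
      using X b unfolding maximal_in_def by auto
    fix Y assume Y: "Y \<in> M b" "Y \<subseteq> A \<inter> {e\<in>S. c e = b}" "X \<inter> {e\<in>S. c e = b} \<subseteq> Y"
    have XS: "X \<subseteq> S" "X \<subseteq> A" using X unfolding maximal_in_def by auto
    have "(X \<union> Y) \<inter> {e\<in>S. c e = b'} \<in> M b'" if b': "b' \<in> c ` S" for b'
    proof (cases "b' = b")
      case True
      then have "(X \<union> Y) \<inter> {e\<in>S. c e = b'} = Y" using Y by auto
      then show ?thesis using Y True by simp
    next
      case False
      then have "(X \<union> Y) \<inter> {e\<in>S. c e = b'} = X \<inter> {e\<in>S. c e = b'}" using Y by auto
      moreover have "X \<inter> {e\<in>S. c e = b'} \<in> M b'" using maximal_inD(1)[OF X] b' by blast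
      ultimately show ?thesis by simp
    qed
    moreover have "X \<union> Y \<subseteq> S" using XS Y by auto
    ultimately have "X \<union> Y \<in> ?D" by simp
    moreover have "X \<union> Y \<subseteq> A" using XS Y by auto
    ultimately have "X \<union> Y = X" by (rule maximal_inD(3)[OF X]) simp
    then show "Y = X \<inter> {e\<in>S. c e = b}" using Y by auto
  qed
  have card_sum: "card X = (\<Sum>b\<in>c ` S. card (X \<inter> {e\<in>S. c e = b}))" if "X \<subseteq> S" for X
  proof -
    have "X = (\<Union>b\<in>c ` S. X \<inter> {e\<in>S. c e = b})" using that by auto
    then have "card X = card (\<Union>b\<in>c ` S. X \<inter> {e\<in>S. c e = b})" by simp
    also have "\<dots> = (\<Sum>b\<in>c ` S. card (X \<inter> {e\<in>S. c e = b}))"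
      using \<open>finite S\<close> by (intro card_UN_disjoint) auto
    finally show ?thesis .
  qed
  have "card X = card Y" if "A \<subseteq> S" and X: "maximal_in ?D A X" and Y: "maximal_in ?D A Y" for A X Y
  proof -
    have "card (X \<inter> {e\<in>S. c e = b}) = card (Y \<inter> {e\<in>S. c e = b})" if b: "b \<in> c ` S" for b
    proof -
      have "A \<inter> {e\<in>S. c e = b} \<subseteq> {e\<in>S. c e = b}" by auto
      then show ?thesis
        using fibre_maximal[OF X b] fibre_maximal[OF Y b] by (rule matroid_on_card_eq[OF mat[OF b]])
    qed
    moreover have "X \<subseteq> S" "Y \<subseteq> S"
      using \<open>A \<subseteq> S\<close> maximal_inD(2)[OF X] maximal_inD(2)[OF Y] by simp_all
    ultimately show ?thesis by (simp add: card_sum)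
  qed
  moreover have "{} \<in> ?D" using matroid_onD(2)[OF mat] by simp
  moreover have "X \<subseteq> S" if "X \<in> ?D" for X using that by simp
  ultimately show ?thesis using \<open>finite S\<close> D_down by (intro matroid_onI)
qed

lemma matroid_on_rank_le_1:
  assumes "finite S"
  shows "matroid_on S {X. X \<subseteq> S \<and> card X \<le> 1}" (is "matroid_on S ?U")
proof -
  have "card X \<ge> card Y" if A: "A \<subseteq> S" and X: "maximal_in ?U A X" and Y: "maximal_in ?U A Y" for A X Y
  proof (rule ccontr)
    assume "\<not> card X \<ge> card Y"
    moreover have fin: "finite X" "finite Y" "card Y \<le> 1" "Y \<subseteq> A" "Y \<in> ?U"
      using X Y assms unfolding maximal_in_def by (auto intro: finite_subset)
    ultimately have "card X = 0" "Y \<noteq> {}" by (linarith, auto)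
    then have "X = {}" using fin by simp
    then show False using X fin \<open>Y \<noteq> {}\<close> unfolding maximal_in_def by blast
  qed
  then have "card X = card Y" if "A \<subseteq> S" "maximal_in ?U A X" "maximal_in ?U A Y" for A X Y
    using that by (meson le_antisym)
  moreover have "Y \<in> ?U" if "X \<in> ?U" "Y \<subseteq> X" for X Y
  proof -
    have "X \<subseteq> S" "card X \<le> 1" using that by auto
    then have "card Y \<le> card X" using that(2) assms by (meson card_mono finite_subset)
    then show ?thesis using that \<open>X \<subseteq> S\<close> \<open>card X \<le> 1\<close> by auto
  qed
  moreover have "X \<subseteq> S" if "X \<in> ?U" for X using that by simp
  moreover have "{} \<in> ?U" by simp
  ultimately show ?thesis using assms by (intro matroid_onI)
qed

section \<open>Representing the matchings by k matroids\<close>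

definition matching_representable :: "nat \<Rightarrow> 'v set set \<Rightarrow> bool" where
  "matching_representable k E \<longleftrightarrow>
     (\<exists>M. (\<forall>i<k. matroid_on E (M i) \<and> matchings E \<subseteq> M i) \<and>
          (\<forall>e\<in>E. \<forall>f\<in>E. e \<noteq> f \<longrightarrow> e \<inter> f \<noteq> {} \<longrightarrow> (\<exists>i<k. {e, f} \<notin> M i)))"

text \<open>Being a matching is a condition on pairs of edges and matroids are closed under subsets.
  Hence excluding each meeting pair from one of the matroids already cuts their intersection down to
  the matchings.\<close>

lemma mu_graph_le:
  assumes "matching_representable k E" and "k \<ge> 1"
  shows "mu_graph E \<le> k"
proof -
  obtain M where M: "\<And>i. i < k \<Longrightarrow> matroid_on E (M i)" "\<And>i. i < k \<Longrightarrow> matchings E \<subseteq> M i"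
    and sep: "\<And>e f. e \<in> E \<Longrightarrow> f \<in> E \<Longrightarrow> e \<noteq> f \<Longrightarrow> e \<inter> f \<noteq> {} \<Longrightarrow> \<exists>i<k. {e, f} \<notin> M i"
    using assms(1) unfolding matching_representable_def by metis
  \<comment> \<open>The shift by one passes from indices below \<open>k\<close> to the range
    \<open>{1..k}\<close> used in \<open>mu_graph\<close>.\<close>
  have "X \<in> matchings E" if X: "X \<in> (\<Inter>i\<in>{1..k}. M (i - 1))" for X
  proof -
    have XM: "X \<in> M i" if "i < k" for i
      using X that by (auto dest: bspec[of _ _ "Suc i"])
    have "X \<subseteq> E" using matroid_on_subset[OF M(1) XM, of 0] assms(2) by simp
    moreover have "disjoint X"
    proof (rule pairwiseI, rule ccontr)
      fix e f assume ef: "e \<in> X" "f \<in> X" "e \<noteq> f" "\<not> disjnt e f"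
      then obtain i where "i < k" "{e, f} \<notin> M i"
        using sep[of e f] \<open>X \<subseteq> E\<close> by (auto simp: disjnt_def)
      then show False using matroid_on_down[OF M(1) XM, of i "{e, f}"] ef by simp
    qed
    ultimately show ?thesis unfolding matchings_def by blast
  qed
  moreover have "matchings E \<subseteq> (\<Inter>i\<in>{1..k}. M (i - 1))" by (intro INT_greatest M(2)) auto
  ultimately have "matchings E = (\<Inter>i\<in>{1..k}. M (i - 1))" by blast
  moreover have "\<forall>i\<in>{1..k}. matroid_on E (M (i - 1))" using M(1) by auto
  ultimately show ?thesis
    unfolding mu_graph_def using assms(2)
    by (intro Least_le conjI exI[of _ "\<lambda>i. M (i - 1)"])
qed

lemma finite_edges: "finite_simple_graph V E \<Longrightarrow> finite E"
  unfolding finite_simple_graph_def by (auto intro: finite_subset[of E "Pow V"])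

text \<open>Two disjoint edges occupy four vertices, so here every matching has at most one edge and
  copies of the rank-one matroid suffice.\<close>

lemma matching_representable_card_le_3:
  assumes G: "finite_simple_graph V E" and "card V \<le> 3" and "k \<ge> 1"
  shows "matching_representable k E"
proof -
  have "card X \<le> 1" if X: "X \<in> matchings E" for X
  proof (rule ccontr)
    assume "\<not> card X \<le> 1"
    then obtain e f where ef: "e \<in> X" "f \<in> X" "e \<noteq> f"
      by (metis One_nat_def card_le_Suc0_iff_eq card.infinite zero_le)
    then have "e \<inter> f = {}" "e \<subseteq> V" "f \<subseteq> V" "card e = 2" "card f = 2" "finite V"
      using X G unfolding matchings_def finite_simple_graph_def disjoint_def by auto
    then have "card (e \<union> f) = 4" "card (e \<union> f) \<le> card V"
      using finite_subset[of _ V] card_Un_disjoint[of e f] card_mono[of V "e \<union> f"] by auto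
    then show False using \<open>card V \<le> 3\<close> by simp
  qed
  then have "matchings E \<subseteq> {X. X \<subseteq> E \<and> card X \<le> 1}" unfolding matchings_def by auto
  then show ?thesis
    unfolding matching_representable_def
    using matroid_on_rank_le_1[OF finite_edges[OF G]] \<open>k \<ge> 1\<close>
    by (intro exI[of _ "\<lambda>_. {X. X \<subseteq> E \<and> card X \<le> 1}"]) (auto intro: exI[of _ 0])
qed

section \<open>Balanced partitions and indices modulo m\<close>

lemma ex_balanced_partition:
  assumes "finite V" and "card V \<le> m * n" and "m > 0"
  shows "\<exists>p. (\<forall>v. p v < m) \<and> (\<forall>i. card {v\<in>V. p v = i} \<le> n)"
proof -
  obtain h where h: "bij_betw h V {0..<card V}"
    using ex_bij_betw_finite_nat[OF assms(1)] by blast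
  \<comment> \<open>The parts are the residue classes of a numbering of \<open>V\<close>; within a
    class the quotient by \<open>m\<close> determines the vertex and is below
    \<open>n\<close>.\<close>
  have "card {v\<in>V. h v mod m = i} \<le> card {..<n}" for i
  proof (rule card_inj_on_le[of "\<lambda>v. h v div m"])
    show "inj_on (\<lambda>v. h v div m) {v\<in>V. h v mod m = i}"
    proof (rule inj_onI)
      fix u v assume *: "u \<in> {v\<in>V. h v mod m = i}" "v \<in> {v\<in>V. h v mod m = i}" "h u div m = h v div m"
      then have "h u = h v" by (metis (mono_tags, lifting) div_mult_mod_eq mem_Collect_eq)
      then show "u = v" using * h by (auto simp: bij_betw_def dest: inj_onD)
    qed
    have "h v div m < n" if "v \<in> V" for v
    proof -
      have "h v < m * n" using that h assms(2) bij_betwE[OF h] by fastforce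
      then show ?thesis by (simp add: less_mult_imp_div_less mult.commute)
    qed
    then show "(\<lambda>v. h v div m) ` {v\<in>V. h v mod m = i} \<subseteq> {..<n}" by auto
  qed simp
  then show ?thesis using assms(3) by (intro exI[of _ "\<lambda>v. h v mod m"]) auto
qed

text \<open>For \<open>i\<close> and \<open>k\<close> below \<open>m\<close> this is the residue of
  k - i modulo \<open>m\<close>: the offset of matroid \<open>k\<close> as seen from part
  \<open>i\<close>.\<close>

definition cyclic_diff :: "nat \<Rightarrow> nat \<Rightarrow> nat \<Rightarrow> nat" where
  "cyclic_diff m i k = (if i \<le> k then k - i else k + m - i)"

text \<open>This is the second matroid in which an edge from part \<open>i\<close> to part
  \<open>j\<close> is charged to its end in part \<open>i\<close>. Offset 1 would collide with
  \<open>j\<close> or with the other end's choice if the parts are cyclic neighbours, so both ends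
  then use offset 2; the indices are i, i+1, i+2, i+3, distinct modulo \<open>m\<close> once m \<ge>
  4.\<close>

definition cross_index :: "nat \<Rightarrow> nat \<Rightarrow> nat \<Rightarrow> nat" where
  "cross_index m i j =
     (if j = (i + 1) mod m \<or> i = (j + 1) mod m then (i + 2) mod m else (i + 1) mod m)"

lemma mod_eq_if: "a < 2 * m \<Longrightarrow> a mod m = (if a < m then a else a - m)" for a m :: nat
  by (simp add: mod_if)

lemma cyclic_diff_self [simp]: "cyclic_diff m i i = 0"
  by (simp add: cyclic_diff_def)

lemma cyclic_diff_less: "i < m \<Longrightarrow> k < m \<Longrightarrow> cyclic_diff m i k < m"
  by (auto simp: cyclic_diff_def)

lemma cyclic_diff_surj:
  assumes "i < m" and "d < m"
  shows "\<exists>k<m. cyclic_diff m i k = d"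
  using assms by (intro exI[of _ "(i + d) mod m"]) (auto simp: cyclic_diff_def mod_eq_if)

lemma cross_index:
  assumes "m \<ge> 4" "i < m" "j < m" "i \<noteq> j"
  shows "cross_index m i j < m"
    and "cyclic_diff m i (cross_index m i j) \<in> {1, 2}"
    and "cross_index m i j \<noteq> i"
    and "cross_index m i j \<noteq> j"
    and "cross_index m i j \<noteq> cross_index m j i"
proof -
  have mods: "(a + 1) mod m = (if a + 1 = m then 0 else a + 1)"
    "(a + 2) mod m = (if a + 2 \<ge> m then a + 2 - m else a + 2)" if "a < m" for a
    using that assms(1) by (auto simp: mod_eq_if)
  define i1 i2 j1 j2 where defs: "i1 = (i + 1) mod m" "i2 = (i + 2) mod m"
    "j1 = (j + 1) mod m" "j2 = (j + 2) mod m"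
  note eqs = defs(1,2)[unfolded mods[OF assms(2)]] defs(3,4)[unfolded mods[OF assms(3)]]
  have ci: "cross_index m i j = (if j = i1 \<or> i = j1 then i2 else i1)"
    "cross_index m j i = (if i = j1 \<or> j = i1 then j2 else j1)"
    by (simp_all add: cross_index_def defs)
  show "cross_index m i j < m" "cross_index m i j \<noteq> i" "cross_index m i j \<noteq> j"
    "cross_index m i j \<noteq> cross_index m j i"
    using assms eqs unfolding ci by (simp_all split: if_splits)
  have "cyclic_diff m i i1 = 1" "cyclic_diff m i i2 = 2"
    using assms(1,2) unfolding cyclic_diff_def eqs by auto
  then show "cyclic_diff m i (cross_index m i j) \<in> {1, 2}"
    unfolding ci by simp
qed

text \<open>The linear order tells the two ends of an edge apart, so that the charging rule can
  treat them differently.\<close>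

lemma card_2_Min_Max:
  fixes e :: "'a::linorder set"
  assumes "card e = 2"
  shows "e = {Min e, Max e}" and "Min e \<noteq> Max e"
proof -
  obtain x y where "e = {x, y}" "x \<noteq> y" using assms by (meson card_2_iff)
  then show "e = {Min e, Max e}" "Min e \<noteq> Max e" by (auto simp: min_def max_def)
qed

section \<open>The induction step: from m - 3 to m matroids\<close>

lemma matching_representable_step:
  fixes V :: "'v::linorder set"
  assumes IH: "\<And>V E. finite_simple_graph (V :: 'v set) E \<Longrightarrow> card V \<le> n \<Longrightarrow>
                 matching_representable (m - 3) E"
    and G: "finite_simple_graph V E" and "card V \<le> m * n" and m: "m \<ge> 4"
  shows "matching_representable m E"
proof -
  have finE: "finite E" using G by (rule finite_edges)
  obtain p where p: "\<And>v. p v < m" and p_card: "\<And>i. card {v\<in>V. p v = i} \<le> n"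
    using ex_balanced_partition[of V m n] G \<open>card V \<le> m * n\<close> m
    unfolding finite_simple_graph_def by auto
  have edge: "e = {Min e, Max e}" "Min e \<noteq> Max e" if "e \<in> E" for e
    using card_2_Min_Max[of e] that G unfolding finite_simple_graph_def by auto
  have end_cases: "u = Min e \<or> u = Max e" if "e \<in> E" "u \<in> e" for u e
    using edge(1)[OF that(1)] that(2) by auto
  define inner where "inner i = {e\<in>E. p (Min e) = i \<and> p (Max e) = i}" for i
  have "finite_simple_graph {v\<in>V. p v = i} (inner i)" for i
    unfolding finite_simple_graph_def
  proof (intro conjI ballI)
    show "finite {v\<in>V. p v = i}" using G unfolding finite_simple_graph_def by auto
    fix e assume e: "e \<in> inner i"
    then have "e \<in> E" by (simp add: inner_def)
    then have "e \<subseteq> V" "card e = 2" using G unfolding finite_simple_graph_def by auto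
    moreover have "p u = i" if "u \<in> e" for u
      using end_cases[OF \<open>e \<in> E\<close> that] e by (auto simp: inner_def)
    ultimately show "e \<subseteq> {v\<in>V. p v = i}" "card e = 2" by auto
  qed
  then have "matching_representable (m - 3) (inner i)" for i
    using IH p_card by blast
  then obtain N where N: "\<And>i j. j < m - 3 \<Longrightarrow> matroid_on (inner i) (N i j)"
    "\<And>i j. j < m - 3 \<Longrightarrow> matchings (inner i) \<subseteq> N i j"
    and N_sep: "\<And>i e f. e \<in> inner i \<Longrightarrow> f \<in> inner i \<Longrightarrow> e \<noteq> f \<Longrightarrow> e \<inter> f \<noteq> {} \<Longrightarrow>
                  \<exists>j<m - 3. {e, f} \<notin> N i j"
    unfolding matching_representable_def by metis
  \<comment> \<open>\<open>Inl u\<close>: charged to the vertex \<open>u\<close>; \<open>Inr i\<close>: governed by the matroid of part \<open>i\<close>.\<close>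
  define lab :: "nat \<Rightarrow> 'v set \<Rightarrow> 'v + nat" where
    "lab k e = (let x = Min e; y = Max e; i = p x; j = p y in
       if i = j then
         if cyclic_diff m i k = 0 then Inl x else if cyclic_diff m i k \<le> 2 then Inl y else Inr i
       else if k = i \<or> k = cross_index m i j then Inl x else Inl y)" for k e
  \<comment> \<open>Offsets 0, 1, 2 from part \<open>i\<close> are spent on charging; offsets 3 to m
    - 1 run through the m - 3 matroids of the part, whence the subtraction of 3.\<close>
  define part where
    "part k b = (case b of Inl u \<Rightarrow> {X. X \<subseteq> {e\<in>E. lab k e = b} \<and> card X \<le> 1}
                         | Inr i \<Rightarrow> N i (cyclic_diff m i k - 3))" for k b
  define M where "M k = {X. X \<subseteq> E \<and> (\<forall>b\<in>lab k ` E. X \<inter> {e\<in>E. lab k e = b} \<in> part k b)}" for k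
  have lab_Inl: "u \<in> e" if "lab k e = Inl u" "e \<in> E" for k e u
    using that edge(1)[OF that(2)] unfolding lab_def Let_def by (auto split: if_splits)
  \<comment> \<open>That the label occurs on some edge is what forces the offset to be at least 3.
    At such an offset every edge inside part \<open>i\<close> carries this label, so the fibre is
    all of \<open>inner i\<close>.\<close>
  have lab_Inr: "{e\<in>E. lab k e = Inr i} = inner i \<and> cyclic_diff m i k - 3 < m - 3"
    if "k < m" "Inr i \<in> lab k ` E" for k i
  proof -
    have d: "cyclic_diff m i k \<ge> 3" "i < m"
      using that p by (auto simp: lab_def Let_def split: if_splits)
    then have "{e\<in>E. lab k e = Inr i} = inner i"
      by (auto simp: lab_def Let_def inner_def split: if_splits)
    moreover have "cyclic_diff m i k - 3 < m - 3"
      using d cyclic_diff_less[OF d(2) that(1)] by auto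
    ultimately show ?thesis by blast
  qed
  have matroid: "matroid_on E (M k)" if "k < m" for k
    unfolding M_def
  proof (rule matroid_on_direct_sum[OF finE])
    fix b assume b: "b \<in> lab k ` E"
    show "matroid_on {e\<in>E. lab k e = b} (part k b)"
    proof (cases b)
      case (Inl u)
      then show ?thesis using matroid_on_rank_le_1[of "{e\<in>E. lab k e = b}"] finE by (simp add: part_def)
    next
      case (Inr i)
      then show ?thesis using lab_Inr[OF that, of i] b N(1) by (simp add: part_def)
    qed
  qed
  have matching: "X \<in> M k" if "k < m" "X \<in> matchings E" for k X
    unfolding M_def
  proof (intro CollectI conjI ballI)
    show XE: "X \<subseteq> E" using that unfolding matchings_def by auto
    have disj: "e = f" if "e \<in> X" "f \<in> X" "u \<in> e" "u \<in> f" for e f u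
      using \<open>X \<in> matchings E\<close> that unfolding matchings_def disjoint_def by auto
    fix b assume b: "b \<in> lab k ` E"
    show "X \<inter> {e\<in>E. lab k e = b} \<in> part k b"
    proof (cases b)
      case (Inl u)
      have "card (X \<inter> {e\<in>E. lab k e = b}) \<le> 1"
        using finE Inl disj[OF _ _ lab_Inl lab_Inl] XE
        by (simp add: card_le_Suc0_iff_eq) blast
      then show ?thesis using Inl by (auto simp: part_def)
    next
      case (Inr i)
      have "X \<inter> inner i \<in> matchings (inner i)"
        using that(2) unfolding matchings_def by (auto intro: pairwise_subset)
      then show ?thesis using Inr lab_Inr[OF that(1), of i] b N(2) by (auto simp: part_def)
    qed
  qed
  have M_part: "X \<inter> {e\<in>E. lab k e = b} \<in> part k b" if "X \<in> M k" "b \<in> lab k ` E" for X k b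
    using that unfolding M_def by blast
  have charged: "{e, f} \<notin> M k" if "e \<in> E" "f \<in> E" "e \<noteq> f" "lab k e = Inl u" "lab k f = Inl u" for e f k u
  proof
    assume "{e, f} \<in> M k"
    moreover have "Inl u \<in> lab k ` E" using that by (metis imageI)
    ultimately have "{e, f} \<inter> {e\<in>E. lab k e = Inl u} \<in> part k (Inl u)" by (rule M_part)
    moreover have "{e, f} \<inter> {e\<in>E. lab k e = Inl u} = {e, f}" using that by auto
    ultimately show False using \<open>e \<noteq> f\<close> by (simp add: part_def)
  qed
  have cross_lab: "\<exists>j. j < m \<and> j \<noteq> p u \<and> lab (p u) e = Inl u \<and> lab (cross_index m (p u) j) e = Inl u"
    if e: "e \<in> E" "u \<in> e" "e \<notin> inner (p u)" for e u
  proof -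
    have ne: "p (Min e) \<noteq> p (Max e)" using e end_cases[of e u] by (auto simp: inner_def)
    note ci = cross_index[OF m p p ne] cross_index[OF m p p ne[symmetric]]
    consider "u = Min e" | "u = Max e" using end_cases e by blast
    then show ?thesis
    proof cases
      case 1
      then show ?thesis using ne p by (intro exI[of _ "p (Max e)"]) (simp add: lab_def)
    next
      case 2
      \<comment> \<open>The larger endpoint takes the last branch of \<open>lab\<close>: by
        \<open>ci\<close>, its two indices avoid both indices reserved for the smaller
        endpoint.\<close>
      then show ?thesis using ne p ci by (intro exI[of _ "p (Min e)"]) (auto simp: lab_def Let_def)
    qed
  qed
  \<comment> \<open>The crossing edge \<open>f\<close> is charged to \<open>u\<close> at offset 0
    and at one of the offsets 1, 2. The first meets the charge of \<open>e\<close> if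
    \<open>u\<close> is its smaller end, the second if \<open>u\<close> is its larger end.\<close>
  have inner_cross: "\<exists>k<m. {e, f} \<notin> M k"
    if e: "e \<in> E" "u \<in> e" "e \<in> inner (p u)" and f: "f \<in> E" "u \<in> f" "f \<notin> inner (p u)" for e f u
  proof -
    obtain j where j: "j < m" "j \<noteq> p u" "lab (p u) f = Inl u" "lab (cross_index m (p u) j) f = Inl u"
      using cross_lab[OF f] by blast
    note ci = cross_index[OF m p j(1) j(2)[symmetric]]
    have "e \<noteq> f" using e f by auto
    consider "u = Min e" | "u = Max e" using end_cases e by blast
    then show ?thesis
    proof cases
      case 1
      then have "lab (p u) e = Inl u" using e(3) by (simp add: lab_def inner_def)
      then show ?thesis using charged[OF e(1) f(1) \<open>e \<noteq> f\<close> _ j(3)] p by blast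
    next
      case 2
      then have "lab (cross_index m (p u) j) e = Inl u"
        using e(3) ci(2) by (auto simp: lab_def inner_def Let_def)
      then show ?thesis using charged[OF e(1) f(1) \<open>e \<noteq> f\<close> _ j(4)] ci(1) by blast
    qed
  qed
  have "\<exists>k<m. {e, f} \<notin> M k" if ef: "e \<in> E" "f \<in> E" "e \<noteq> f" "e \<inter> f \<noteq> {}" for e f
  proof -
    obtain u where u: "u \<in> e" "u \<in> f" using ef by blast
    consider "e \<in> inner (p u)" "f \<in> inner (p u)" | "e \<in> inner (p u)" "f \<notin> inner (p u)"
      | "e \<notin> inner (p u)" "f \<in> inner (p u)" | "e \<notin> inner (p u)" "f \<notin> inner (p u)" by blast
    then show ?thesis
    proof cases
      case 1
      then obtain j where j: "j < m - 3" "{e, f} \<notin> N (p u) j" using N_sep ef by blast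
      then obtain k where k: "k < m" "cyclic_diff m (p u) k = j + 3"
        using cyclic_diff_surj[OF p, of "j + 3" u] less_diff_conv[of j m 3] by blast
      then have lab: "lab k e = Inr (p u)" "lab k f = Inr (p u)"
        using 1 by (auto simp: lab_def inner_def Let_def)
      then have "{e, f} \<inter> {e\<in>E. lab k e = Inr (p u)} = {e, f}" using ef by auto
      moreover have "Inr (p u) \<in> lab k ` E" using lab(1) ef(1) by (metis imageI)
      moreover have "{e, f} \<notin> part k (Inr (p u))" using j k by (simp add: part_def)
      ultimately have "{e, f} \<notin> M k" using M_part[of "{e, f}" k "Inr (p u)"] by metis
      then show ?thesis using k by blast
    next
      case 2
      then show ?thesis using inner_cross ef u by blast
    next
      case 3
      then show ?thesis using inner_cross[of f u e] ef u by (simp add: insert_commute)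
    next
      case 4
      then have "lab (p u) e = Inl u" "lab (p u) f = Inl u" using cross_lab ef u by blast+
      then show ?thesis using charged ef p by blast
    qed
  qed
  then show ?thesis
    unfolding matching_representable_def using matroid matching by (intro exI[of _ M]) blast
qed

section \<open>The bound on \<open>nu\<close> and its recursion\<close>

lemma nu_ge:
  assumes "\<And>V E. finite_simple_graph (V :: nat set) E \<Longrightarrow> card V \<le> n \<Longrightarrow> matching_representable m E"
    and "m \<ge> 1"
  shows "nu m \<ge> enat n"
proof -
  let ?S = "{mu_graph E | (V :: nat set) E. finite_simple_graph V E \<and> card V \<le> n}"
  have le: "x \<le> m" if "x \<in> ?S" for x using that assms mu_graph_le by blast
  \<comment> \<open>\<open>Max\<close> in \<open>mu\<close> needs a nonempty finite set: the empty
    graph supplies a member, and the bound \<open>m\<close> on all values gives finiteness although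
    there are infinitely many graphs.\<close>
  have "finite_simple_graph ({} :: nat set) {}" by (simp add: finite_simple_graph_def)
  then have "?S \<noteq> {}" by fastforce
  moreover have "finite ?S" using le by (intro finite_subset[of ?S "{..m}"]) blast+
  ultimately have "mu n \<le> m" unfolding mu_def using le by (subst Max_le_iff) auto
  then show ?thesis unfolding nu_def by (intro SUP_upper) simp
qed

definition vertex_bound :: "nat \<Rightarrow> int" where
  "vertex_bound m = 3 * (\<Prod>i\<in>{0..\<lceil>real m / 3\<rceil> - 2}. (int m - 3 * i))"

lemma vertex_bound_le_3: "m \<le> 3 \<Longrightarrow> vertex_bound m = 3"
proof -
  assume "m \<le> 3"
  then have "\<lceil>real m / 3\<rceil> \<le> 1" by (simp add: ceiling_le_iff)
  then show ?thesis by (simp add: vertex_bound_def)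
qed

text \<open>Split off the factor at i = 0 and shift the index by one: m - 3(i + 1) = (m - 3) - 3i,
  and the upper limit drops by one.\<close>

lemma vertex_bound_rec:
  assumes "m \<ge> 4"
  shows "vertex_bound m = int m * vertex_bound (m - 3)"
proof -
  define t where "t = \<lceil>real (m - 3) / 3\<rceil> - 2"
  have "real m / 3 = real (m - 3) / 3 + 1" using assms by (simp add: field_simps)
  then have t: "\<lceil>real m / 3\<rceil> - 2 = t + 1" unfolding t_def by (simp only: ceiling_add_one)
  have "0 < real (m - 3) / 3" using assms by simp
  \<comment> \<open>This puts 0 into the range up to t + 1. For m from 4 to 6 equality holds and the
    remaining product is empty.\<close>
  then have "t \<ge> -1" unfolding t_def by linarith
  have "{0..t + 1} = insert 0 ((\<lambda>i. i + 1) ` {0..t})"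
  proof (intro equalityI subsetI)
    fix i assume "i \<in> {0..t + 1}"
    then have "i = 0 \<or> i - 1 \<in> {0..t}" by auto
    then show "i \<in> insert 0 ((\<lambda>i. i + 1) ` {0..t})" by (force simp: image_iff)
  qed (use \<open>t \<ge> -1\<close> in auto)
  then have "(\<Prod>i\<in>{0..t + 1}. (int m - 3 * i)) =
      int m * (\<Prod>i\<in>(\<lambda>i. i + 1) ` {0..t}. (int m - 3 * i))"
    by simp
  also have "(\<Prod>i\<in>(\<lambda>i. i + 1) ` {0..t}. (int m - 3 * i)) = (\<Prod>i\<in>{0..t}. (int (m - 3) - 3 * i))"
    using assms by (subst prod.reindex) (auto simp: of_nat_diff algebra_simps intro!: prod.cong)
  finally show ?thesis unfolding vertex_bound_def t t_def[symmetric] by simp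
qed

lemma matching_representable_vertex_bound:
  assumes "m \<ge> 1" and "finite_simple_graph (V :: 'v::linorder set) E" and "card V \<le> nat (vertex_bound m)"
  shows "matching_representable m E"
  using assms
proof (induction m arbitrary: V E rule: less_induct)
  case (less m)
  show ?case
  proof (cases "m \<le> 3")
    case True
    then show ?thesis
      using less.prems by (intro matching_representable_card_le_3) (auto simp: vertex_bound_le_3)
  next
    case False
    then have m: "m \<ge> 4" by simp
    show ?thesis
    proof (rule matching_representable_step[OF _ less.prems(2) _ m])
      show "card V \<le> m * nat (vertex_bound (m - 3))"
        using less.prems(3) by (simp add: vertex_bound_rec[OF m] nat_mult_distrib)
      show "matching_representable (m - 3) E'"
        if "finite_simple_graph V' E'" "card V' \<le> nat (vertex_bound (m - 3))" for V' :: "'v set" and E'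
        using less.IH[of "m - 3" V' E'] m that by auto
    qed
  qed
qed

theorem theorem5:
  fixes m :: nat
  assumes "m \<ge> 1"
  shows "nu m \<ge> enat (nat (3 * (\<Prod>i\<in>{0..\<lceil>real m / 3\<rceil> - 2}. (int m - 3 * i))))"
  unfolding vertex_bound_def[symmetric]
  using matching_representable_vertex_bound[OF assms] assms by (rule nu_ge)

end
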